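(* Let $\bar M(y)=M(0)+\sum_{i=1}^N M_i y_i$ with real symmetric matrices $M(0),M_1,\dots,M_N$ of the same size, $M_i\neq0$ for all $i$, let $c\in\mathbb R^N$, $\mu>0$, and let $Z^k,X^k$ be fixed symmetric matrices of that size. Consider the update $$y^{k+1}=\arg\min_{y}L_\mu(Z^k,y,X^k),\qquad L_\mu(Z,y,X)=c^Ty+\langle Z,\bar M(y)-X\rangle+\frac1{2\mu}\|\bar M(y)-X\|_F^2 .$$ For every $i\in\{1,\dots,N\}$, the first-order optimality condition of this problem for the $i$-th coordinate of $y$ (with the other coordinates $y_j$, $j\ne i$, held fixed) yields $$y_i^{k+1}=\frac{-a_2(i)}{2a_1(i)},$$ where $$a_1(i)=\frac1{2\mu}\mathrm{tr}(M_iM_i^T),$$ $$a_2(i)=c_i+\mathrm{tr}(Z^kM_i^T)+\sum_{j\ne i}\frac1\mu\mathrm{tr}(M_jy_jM_i^T)+\frac1\mu\mathrm{tr}(M(0)M_i^T)-\frac1\mu\mathrm{tr}(M_i^TX^k).$$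
   Context: $\langle A,B\rangle=\mathrm{tr}(A^TB)$ is the trace inner product and $\|A\|_F$ the Frobenius norm. $L_\mu$ is the augmented Lagrangian of the semidefinite program $\inf_{y,X}c^Ty$ subject to $\bar M(y)=X$, $X\succeq0$. *)

theory Defs
  imports "HOL-Analysis.Analysis"
begin

definition trace_inner :: "real^'n^'n \<Rightarrow> real^'n^'n \<Rightarrow> real" where
  "trace_inner A B = trace (transpose A ** B)"

lemma trace_inner_eq_inner: "trace_inner A B = A \<bullet> B"
  unfolding trace_inner_def trace_def transpose_def matrix_matrix_mult_def inner_vec_def
  by (simp, rule sum.swap)

text \<open>The library norm on \<^typ>\<open>real^'n^'n\<close> is the Frobenius norm.\<close>

lemma norm_eq_Frobenius: "norm A = sqrt (trace_inner A A)"
  for A :: "real^'n^'n"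
  by (simp add: trace_inner_eq_inner norm_eq_sqrt_inner)

definition Mbar :: "real^'n^'n \<Rightarrow> ('m::finite \<Rightarrow> real^'n^'n) \<Rightarrow> real^'m \<Rightarrow> real^'n^'n" where
  "Mbar M0 M y = M0 + (\<Sum>i\<in>UNIV. y $ i *\<^sub>R M i)"

definition aug_Lagrangian ::
  "real \<Rightarrow> real^'m \<Rightarrow> real^'n^'n \<Rightarrow> ('m::finite \<Rightarrow> real^'n^'n) \<Rightarrow>
    real^'n^'n \<Rightarrow> real^'m \<Rightarrow> real^'n^'n \<Rightarrow> real" where
  "aug_Lagrangian \<mu> c M0 M Z y X =
     c \<bullet> y + trace_inner Z (Mbar M0 M y - X) + 1 / (2 * \<mu>) * (norm (Mbar M0 M y - X))\<^sup>2"

definition set_coord :: "real^'m \<Rightarrow> 'm::finite \<Rightarrow> real \<Rightarrow> real^'m" where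
  "set_coord y i t = (\<chi> j. if j = i then t else y $ j)"

definition a1 :: "real \<Rightarrow> ('m::finite \<Rightarrow> real^'n^'n) \<Rightarrow> 'm \<Rightarrow> real" where
  "a1 \<mu> M i = 1 / (2 * \<mu>) * trace (M i ** transpose (M i))"

definition a2 ::
  "real \<Rightarrow> real^'m \<Rightarrow> real^'n^'n \<Rightarrow> ('m::finite \<Rightarrow> real^'n^'n) \<Rightarrow>
    real^'n^'n \<Rightarrow> real^'n^'n \<Rightarrow> real^'m \<Rightarrow> 'm \<Rightarrow> real" where
  "a2 \<mu> c M0 M Z X y i =
     c $ i + trace (Z ** transpose (M i))
     + (\<Sum>j\<in>UNIV - {i}. 1 / \<mu> * trace ((y $ j *\<^sub>R M j) ** transpose (M i)))
     + 1 / \<mu> * trace (M0 ** transpose (M i))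
     - 1 / \<mu> * trace (transpose (M i) ** X)"

end

theory Submission
  imports Defs
begin

text \<open>Along a coordinate line the augmented Lagrangian is the quadratic polynomial
  $a_1(i) s^2 + a_2(i) s + \mathrm{const}$, with positive leading coefficient
  since $M_i \neq 0$. A global minimiser in $y$ also minimises along each coordinate line
  through it.\<close>

lemma trace_mult_transpose_eq_inner: "trace (A ** transpose B) = A \<bullet> B"
  for A B :: "real^'n^'n"
  using trace_inner_eq_inner[of B A]
  by (simp add: trace_inner_def trace_mul_sym[of A] inner_commute)

lemma set_coord_conv: "set_coord y i s = set_coord y i 0 + s *\<^sub>R axis i 1"
  by (simp add: set_coord_def vec_eq_iff axis_def)

lemma set_coord_same: "set_coord y i (y $ i) = y"
  by (simp add: set_coord_def vec_eq_iff)

text \<open>Zeroing coordinate \<open>i\<close> deletes the summand of \<open>M i\<close>, which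
  produces the sum over \<open>j \<noteq> i\<close> that appears in \<open>a2\<close>.\<close>

lemma Mbar_set_coord_0:
  "Mbar M0 M (set_coord y i 0) = M0 + (\<Sum>j\<in>UNIV - {i}. y $ j *\<^sub>R M j)"
  by (simp add: Mbar_def set_coord_def sum.remove[of UNIV i])

lemma Mbar_set_coord:
  "Mbar M0 M (set_coord y i s) = Mbar M0 M (set_coord y i 0) + s *\<^sub>R M i"
  by (simp add: Mbar_def set_coord_def sum.remove[of UNIV i])

lemma a1_eq_norm: "a1 \<mu> M i = 1 / (2 * \<mu>) * (norm (M i))\<^sup>2"
  by (simp add: a1_def trace_mult_transpose_eq_inner power2_norm_eq_inner)

text \<open>The sum over \<open>j \<noteq> i\<close>, the \<open>M0\<close> term and the
  \<open>X\<close> term of \<open>a2\<close> are all inner products with \<open>M i\<close>;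
  together they form the residual at coordinate value 0. This displays \<open>a2\<close> as the
  slope of the coordinate line at 0.\<close>

lemma a2_eq_inner:
  "a2 \<mu> c M0 M Z X y i =
     c $ i + Z \<bullet> M i + 1 / \<mu> * ((Mbar M0 M (set_coord y i 0) - X) \<bullet> M i)"
proof -
  have "trace (transpose (M i) ** X) = X \<bullet> M i"
    using trace_inner_eq_inner[of "M i" X] by (simp add: trace_inner_def inner_commute)
  then show ?thesis
    by (simp add: a2_def trace_mult_transpose_eq_inner Mbar_set_coord_0 inner_diff_left
        inner_add_left inner_sum_left sum_divide_distrib diff_divide_distrib add_divide_distrib)
qed

text \<open>The residual is affine in \<open>s\<close> with direction \<open>M i\<close>, so only
  the squared norm contributes an \<open>s\<^sup>2\<close> term. The coefficient \<open>a2\<close>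
  may be taken at \<open>y\<close> because it does not involve \<open>y $ i\<close>.\<close>

lemma aug_Lagrangian_set_coord:
  "aug_Lagrangian \<mu> c M0 M Z (set_coord y i s) X =
     a1 \<mu> M i * s\<^sup>2 + a2 \<mu> c M0 M Z X y i * s
       + aug_Lagrangian \<mu> c M0 M Z (set_coord y i 0) X"
proof -
  define R where "R = Mbar M0 M (set_coord y i 0) - X"
  have M: "Mbar M0 M (set_coord y i s) - X = R + s *\<^sub>R M i"
    by (simp add: R_def Mbar_set_coord[of M0 M y i s])
  have c: "c \<bullet> set_coord y i s = c \<bullet> set_coord y i 0 + s * c $ i"
    by (subst set_coord_conv) (simp add: inner_add_right inner_axis)
  \<comment> \<open>The factor 2 of the cross term turns the weight \<open>1 / (2 * \<mu>)\<close>
    into the \<open>1 / \<mu>\<close> found in \<open>a2\<close>.\<close>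
  have n: "(norm (R + s *\<^sub>R M i))\<^sup>2 = (norm R)\<^sup>2 + 2 * s * (R \<bullet> M i) + s\<^sup>2 * (norm (M i))\<^sup>2"
    unfolding power2_norm_eq_inner
    by (simp add: inner_add_left inner_add_right inner_commute power2_eq_square)
  show ?thesis
    unfolding aug_Lagrangian_def trace_inner_eq_inner M c n a1_eq_norm a2_eq_inner
      R_def[symmetric]
    by (simp add: inner_add_right field_simps add_divide_distrib)
qed

lemma quadratic_critical_point_iff:
  fixes a b k t :: real
  assumes "a > 0"
  shows "((\<lambda>s. a * s\<^sup>2 + b * s + k) has_real_derivative 0) (at t) \<longleftrightarrow> t = - b / (2 * a)"
proof -
  have D: "((\<lambda>s. a * s\<^sup>2 + b * s + k) has_real_derivative 2 * a * t + b) (at t)"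
    by (auto intro!: derivative_eq_intros)
  then have "((\<lambda>s. a * s\<^sup>2 + b * s + k) has_real_derivative 0) (at t) \<longleftrightarrow> 2 * a * t + b = 0"
    by (metis DERIV_unique)
  also have "\<dots> \<longleftrightarrow> t = - b / (2 * a)"
    using assms by (auto simp: field_simps)
  finally show ?thesis .
qed

text \<open>Completing the square around the vertex \<open>m\<close> leaves a positive multiple of
  \<open>(s - m)\<^sup>2\<close> plus a constant, so minimality is a comparison of squared distances
  to \<open>m\<close>.\<close>

lemma quadratic_is_arg_min_iff:
  fixes a b k t :: real
  assumes "a > 0"
  shows "is_arg_min (\<lambda>s. a * s\<^sup>2 + b * s + k) (\<lambda>_. True) t \<longleftrightarrow> t = - b / (2 * a)"
proof -
  define m where "m = - b / (2 * a)"
  have b: "b = - 2 * a * m"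
    using assms by (simp add: m_def)
  have sq: "a * s\<^sup>2 + b * s + k = a * (s - m)\<^sup>2 + (k - a * m\<^sup>2)" for s
    unfolding b by (simp add: power2_eq_square algebra_simps)
  have "is_arg_min (\<lambda>s. a * s\<^sup>2 + b * s + k) (\<lambda>_. True) t \<longleftrightarrow> (\<forall>s. (t - m)\<^sup>2 \<le> (s - m)\<^sup>2)"
    unfolding sq is_arg_min_linorder using assms by simp
  \<comment> \<open>Taking \<open>s = m\<close> forces
    \<open>(t - m)\<^sup>2 \<le> 0\<close>.\<close>
  also have "\<dots> \<longleftrightarrow> t = m"
    by (metis diff_self eq_iff_diff_eq_0 power2_less_eq_zero_iff zero_le_power2 zero_power2)
  finally show ?thesis
    by (simp add: m_def)
qed

theorem proposition2:
  fixes M0 Z X :: "real^'n^'n"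
    and M :: "'m::finite \<Rightarrow> real^'n^'n"
    and c :: "real^'m"
    and \<mu> :: real
    and i :: 'm
  assumes "transpose M0 = M0"
    and "\<And>j. transpose (M j) = M j"
    and "\<And>j. M j \<noteq> 0"
    and "transpose Z = Z"
    and "transpose X = X"
    and "\<mu> > 0"
  shows "(\<forall>y t. ((\<lambda>s. aug_Lagrangian \<mu> c M0 M Z (set_coord y i s) X)
                    has_real_derivative 0) (at t)
            \<longleftrightarrow> t = - a2 \<mu> c M0 M Z X y i / (2 * a1 \<mu> M i))
       \<and> (\<forall>y t. is_arg_min (\<lambda>s. aug_Lagrangian \<mu> c M0 M Z (set_coord y i s) X) (\<lambda>_. True) t
            \<longleftrightarrow> t = - a2 \<mu> c M0 M Z X y i / (2 * a1 \<mu> M i))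
       \<and> (\<forall>ynext. is_arg_min (\<lambda>y. aug_Lagrangian \<mu> c M0 M Z y X) (\<lambda>_. True) ynext
            \<longrightarrow> ynext $ i = - a2 \<mu> c M0 M Z X ynext i / (2 * a1 \<mu> M i))"
proof -
  have a1: "a1 \<mu> M i > 0"
    using assms(3)[of i] assms(6) by (simp add: a1_eq_norm)
  have line: "(\<lambda>s. aug_Lagrangian \<mu> c M0 M Z (set_coord y i s) X) =
      (\<lambda>s. a1 \<mu> M i * s\<^sup>2 + a2 \<mu> c M0 M Z X y i * s
        + aug_Lagrangian \<mu> c M0 M Z (set_coord y i 0) X)" for y
    by (rule ext) (rule aug_Lagrangian_set_coord)
  have arg_min: "is_arg_min (\<lambda>s. aug_Lagrangian \<mu> c M0 M Z (set_coord y i s) X) (\<lambda>_. True) t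
      \<longleftrightarrow> t = - a2 \<mu> c M0 M Z X y i / (2 * a1 \<mu> M i)" for y t
    unfolding line using quadratic_is_arg_min_iff[OF a1] .
  \<comment> \<open>By \<open>set_coord_same\<close>, the minimiser lies on its own coordinate line
    at parameter \<open>y $ i\<close>. Applying \<open>arg_min\<close> there yields the update
    formula with \<open>a2\<close> evaluated at the minimiser itself.\<close>
  have "is_arg_min (\<lambda>s. aug_Lagrangian \<mu> c M0 M Z (set_coord y i s) X) (\<lambda>_. True) (y $ i)"
    if "is_arg_min (\<lambda>y. aug_Lagrangian \<mu> c M0 M Z y X) (\<lambda>_. True) y" for y
    using that by (simp add: is_arg_min_linorder set_coord_same)
  moreover have "((\<lambda>s. aug_Lagrangian \<mu> c M0 M Z (set_coord y i s) X)
        has_real_derivative 0) (at t)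
      \<longleftrightarrow> t = - a2 \<mu> c M0 M Z X y i / (2 * a1 \<mu> M i)" for y t
    unfolding line using quadratic_critical_point_iff[OF a1] .
  ultimately show ?thesis
    using arg_min by blast
qed

end
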